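(* Let $a\in\mathbb{C}$ and let $(\mathfrak{L},\cdot,[\;,\;])$ be a transposed Poisson algebra structure defined on the Lie algebra $\mathcal{W}(a,-1)$, with basis $\{L_i,I_j\}_{i,j\in\mathbb{Z}}$. Then $(\mathfrak{L},\cdot,[\;,\;])$ is not a Poisson algebra, and $(\mathfrak{L},\cdot)$ is a mutation of the algebra $\mathbb{L}$ of extended Laurent polynomials; that is, there is an element $w\in\mathbb{L}$ such that $x\cdot y=x\,w\,y$ for all $x,y$, where juxtaposition is the product of $\mathbb{L}$ (realized on the same basis). Conversely, every nonzero mutation of $\mathbb{L}$ gives, together with the bracket of $\mathcal{W}(a,-1)$ on the same vector space, a transposed Poisson algebra whose Lie part is $\mathcal{W}(a,-1)$.
   Context: $\mathcal{W}(a,-1)$ is the complex Lie algebra with basis $\{L_i,I_j\}_{i,j\in\mathbb{Z}}$ and brackets $[L_m,L_n]=(m-n)L_{m+n}$, $[L_m,I_n]=-(n+a-m)I_{m+n}$, $[I_m,I_n]=0$. The algebra $\mathbb{L}$ of extended Laurent polynomials is the commutative algebra with basis $\{L_i,I_j\}_{i,j\in\mathbb{Z}}$ and products $L_iL_j=L_{i+j}$, $L_iI_j=I_{i+j}$, $I_iI_j=0$. The mutation of a commutative associative algebra $A$ by $p\in A$ is the vector space $A$ with product $x\cdot_p y=x\,p\,y$. A transposed Poisson algebra is a vector space $\mathfrak{L}$ with two nonzero bilinear operations $\cdot$ and $[\;,\;]$ such that $(\mathfrak{L},\cdot)$ is commutative and associative, $(\mathfrak{L},[\;,\;])$ is a Lie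 algebra, and $2z\cdot[x,y]=[z\cdot x,y]+[x,z\cdot y]$ for all $x,y,z$. A triple with $\cdot$ commutative associative and $[\;,\;]$ Lie is a Poisson algebra if $[x,y\cdot z]=[x,y]\cdot z+y\cdot[x,z]$ for all $x,y,z$. *)

theory Defs
  imports Complex_Main "HOL-Library.Poly_Mapping"
begin

locale bilinear_operation = vector_space scale
  for scale :: "'k::field \<Rightarrow> 'v::ab_group_add \<Rightarrow> 'v" +
  fixes bop :: "'v \<Rightarrow> 'v \<Rightarrow> 'v"
  assumes linear_left: "Vector_Spaces.linear scale scale (\<lambda>x. bop x y)"
    and linear_right: "Vector_Spaces.linear scale scale (\<lambda>y. bop x y)"

locale comm_assoc_algebra = bilinear_operation scale mul
  for scale :: "'k::field \<Rightarrow> 'v::ab_group_add \<Rightarrow> 'v" and mul :: "'v \<Rightarrow> 'v \<Rightarrow> 'v" +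
  assumes mul_commute: "mul x y = mul y x"
    and mul_assoc: "mul (mul x y) z = mul x (mul y z)"

locale lie_algebra = bilinear_operation scale brk
  for scale :: "'k::field \<Rightarrow> 'v::ab_group_add \<Rightarrow> 'v" and brk :: "'v \<Rightarrow> 'v \<Rightarrow> 'v" +
  assumes brk_self: "brk x x = 0"
    and jacobi: "brk x (brk y z) + brk y (brk z x) + brk z (brk x y) = 0"

locale transposed_poisson_algebra =
  mult: comm_assoc_algebra scale mul + lie: lie_algebra scale brk
  for scale :: "'k::field \<Rightarrow> 'v::ab_group_add \<Rightarrow> 'v"
    and mul :: "'v \<Rightarrow> 'v \<Rightarrow> 'v" and brk :: "'v \<Rightarrow> 'v \<Rightarrow> 'v" +
  assumes mul_nonzero: "\<exists>x y. mul x y \<noteq> 0"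
    and brk_nonzero: "\<exists>x y. brk x y \<noteq> 0"
    and transposed_leibniz:
      "scale 2 (mul z (brk x y)) = brk (mul z x) y + brk x (mul z y)"

locale poisson_algebra =
  mult: comm_assoc_algebra scale mul + lie: lie_algebra scale brk
  for scale :: "'k::field \<Rightarrow> 'v::ab_group_add \<Rightarrow> 'v"
    and mul :: "'v \<Rightarrow> 'v \<Rightarrow> 'v" and brk :: "'v \<Rightarrow> 'v \<Rightarrow> 'v" +
  assumes leibniz: "brk x (mul y z) = mul (brk x y) z + mul y (brk x z)"

definition mutation :: "('v \<Rightarrow> 'v \<Rightarrow> 'v) \<Rightarrow> 'v \<Rightarrow> 'v \<Rightarrow> 'v \<Rightarrow> 'v" where
  "mutation mul p x y = mul (mul x p) y"

datatype basis = L int | I int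

text \<open>The free complex vector space on the symbols \<open>L i\<close>, \<open>I j\<close>: finitely supported
  coefficient functions, the basis vectors being \<open>Poly_Mapping.single b 1\<close>.\<close>

type_synonym wspace = "basis \<Rightarrow>\<^sub>0 complex"

definition wscale :: "complex \<Rightarrow> wspace \<Rightarrow> wspace" where
  "wscale c = Poly_Mapping.map (\<lambda>z. c * z)"

definition bilinear_extension :: "(basis \<Rightarrow> basis \<Rightarrow> wspace) \<Rightarrow> wspace \<Rightarrow> wspace \<Rightarrow> wspace" where
  "bilinear_extension f x y =
     (\<Sum>i\<in>Poly_Mapping.keys x. \<Sum>j\<in>Poly_Mapping.keys y.
       wscale (Poly_Mapping.lookup x i * Poly_Mapping.lookup y j) (f i j))"

fun W_bracket_basis :: "complex \<Rightarrow> basis \<Rightarrow> basis \<Rightarrow> wspace" where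
  "W_bracket_basis a (L m) (L n) = Poly_Mapping.single (L (m + n)) (of_int (m - n))"
| "W_bracket_basis a (L m) (I n) = Poly_Mapping.single (I (m + n)) (- (of_int n + a - of_int m))"
| "W_bracket_basis a (I m) (L n) = Poly_Mapping.single (I (m + n)) (of_int m + a - of_int n)"
| "W_bracket_basis a (I m) (I n) = 0"

definition W_bracket :: "complex \<Rightarrow> wspace \<Rightarrow> wspace \<Rightarrow> wspace" where
  "W_bracket a = bilinear_extension (W_bracket_basis a)"

fun laurent_mult_basis :: "basis \<Rightarrow> basis \<Rightarrow> wspace" where
  "laurent_mult_basis (L i) (L j) = Poly_Mapping.single (L (i + j)) 1"
| "laurent_mult_basis (L i) (I j) = Poly_Mapping.single (I (i + j)) 1"
| "laurent_mult_basis (I i) (L j) = Poly_Mapping.single (I (i + j)) 1"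
| "laurent_mult_basis (I i) (I j) = 0"

definition laurent_mult :: "wspace \<Rightarrow> wspace \<Rightarrow> wspace" where
  "laurent_mult = bilinear_extension laurent_mult_basis"

lemma lookup_wscale [simp]: "Poly_Mapping.lookup (wscale c x) b = c * Poly_Mapping.lookup x b"
  by (simp add: wscale_def Poly_Mapping.map.rep_eq when_def)

interpretation wspace: vector_space wscale
  by unfold_locales (auto intro!: poly_mapping_eqI simp: Poly_Mapping.lookup_add algebra_simps)

lemma bilinear_extension_single [simp]:
  "bilinear_extension f (Poly_Mapping.single i 1) (Poly_Mapping.single j 1) = f i j"
  by (simp add: bilinear_extension_def)

lemma bilinear_extension_superset:
  assumes "finite A" "finite B" "Poly_Mapping.keys x \<subseteq> A" "Poly_Mapping.keys y \<subseteq> B"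
  shows "bilinear_extension f x y =
    (\<Sum>i\<in>A. \<Sum>j\<in>B. wscale (Poly_Mapping.lookup x i * Poly_Mapping.lookup y j) (f i j))"
proof -
  have "(\<Sum>j\<in>Poly_Mapping.keys y. wscale (Poly_Mapping.lookup x i * Poly_Mapping.lookup y j) (f i j)) =
      (\<Sum>j\<in>B. wscale (Poly_Mapping.lookup x i * Poly_Mapping.lookup y j) (f i j))" for i
    by (rule sum.mono_neutral_left) (use assms in \<open>auto simp: in_keys_iff\<close>)
  then show ?thesis
    unfolding bilinear_extension_def
    by simp (rule sum.mono_neutral_left, use assms in \<open>auto simp: in_keys_iff\<close>)
qed

lemma bilinear_operation_extension: "bilinear_operation wscale (bilinear_extension f)"
proof -
  have supp: "Poly_Mapping.keys (wscale c x) \<subseteq> Poly_Mapping.keys x" for c x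
    by (auto simp: in_keys_iff)
  have l1: "bilinear_extension f (x + y) z = bilinear_extension f x z + bilinear_extension f y z"
    for x y z
    by (subst (1 2 3) bilinear_extension_superset[where A = "Poly_Mapping.keys x \<union> Poly_Mapping.keys y" and B = "Poly_Mapping.keys z"])
      (use Poly_Mapping.keys_add[of x y] in \<open>auto simp: Poly_Mapping.lookup_add distrib_right wspace.scale_left_distrib
        sum.distrib\<close>)
  have r1: "bilinear_extension f z (x + y) = bilinear_extension f z x + bilinear_extension f z y"
    for x y z
    by (subst (1 2 3) bilinear_extension_superset[where B = "Poly_Mapping.keys x \<union> Poly_Mapping.keys y" and A = "Poly_Mapping.keys z"])
      (use Poly_Mapping.keys_add[of x y] in \<open>auto simp: Poly_Mapping.lookup_add distrib_left wspace.scale_left_distrib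
        sum.distrib\<close>)
  have l2: "bilinear_extension f (wscale c x) z = wscale c (bilinear_extension f x z)" for c x z
    by (subst (1 2) bilinear_extension_superset[where A = "Poly_Mapping.keys x" and B = "Poly_Mapping.keys z"])
      (use supp[of c x] in \<open>auto simp: wspace.scale_sum_right mult.assoc\<close>)
  have r2: "bilinear_extension f z (wscale c x) = wscale c (bilinear_extension f z x)" for c x z
    by (subst (1 2) bilinear_extension_superset[where B = "Poly_Mapping.keys x" and A = "Poly_Mapping.keys z"])
      (use supp[of c x] in \<open>auto simp: wspace.scale_sum_right ac_simps\<close>)
  show ?thesis
    by unfold_locales (simp_all add: l1 l2 r1 r2)
qed

end

theory Submission
  imports Defs
begin

text \<open>
  Give \<open>L m\<close> the weight \<open>m\<close> and \<open>I n\<close> the weight \<open>n + a\<close>. Multiplying a basis vector by its weight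
  is a derivation \<open>D\<close> of the algebra of extended Laurent polynomials, because weights add up under
  the product and products of two \<open>I\<close>'s vanish. The bracket of \<open>\<W>(a, -1)\<close> is then the Wronskian
  bracket \<open>[x, y] = D x * y - x * D y\<close>, and most of the proof uses only this formula.

  Over any commutative algebra with a derivation, multiplication by a fixed element \<open>u\<close> is a
  half-derivation of the Wronskian bracket: \<open>2 u [x, y] = [u x, y] + [x, u y]\<close>, since the two terms
  with \<open>D u\<close> cancel. Hence every nonzero mutation is a transposed Poisson structure.

  For the classification (\<open>half_derivation_eq_multiplication\<close>), every half-derivation \<open>\<phi>\<close> of
  \<open>\<W>(a, -1)\<close> is multiplication by \<open>\<phi> 1\<close>, where \<open>1 = L 0\<close>. The difference \<open>\<psi>\<close> of the two is a
  half-derivation with \<open>\<psi> 1 = 0\<close>, and evaluating it on \<open>[x, 1] = D x\<close> gives \<open>D (\<psi> x) = 2 \<psi> (D x)\<close>: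
  thus \<open>\<psi>\<close> doubles weights. For \<open>x\<close>, \<open>y\<close> of weights \<open>\<alpha>\<close>, \<open>\<beta>\<close> the three terms of
  \<open>2 \<psi> [x, y] = [\<psi> x, y] + [x, \<psi> y]\<close> have weights \<open>2 \<alpha> + 2 \<beta>\<close>, \<open>2 \<alpha> + \<beta>\<close> and \<open>\<alpha> + 2 \<beta>\<close>. When
  the second weight differs from the other two, \<open>[\<psi> x, y]\<close> vanishes; taking for \<open>y\<close> a suitable
  invertible element \<open>L n\<close> yields \<open>\<psi> x = 0\<close>. Now if \<open>\<cdot>\<close> is a transposed Poisson product, each \<open>x \<mapsto> z \<cdot> x\<close> is a half-derivation, so
  \<open>z \<cdot> x = (z \<cdot> 1) x\<close>, and by commutativity \<open>z \<cdot> 1 = 1 \<cdot> z = (1 \<cdot> 1) z\<close>. Therefore \<open>\<cdot>\<close> is the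
  mutation by \<open>w = 1 \<cdot> 1\<close>.

  If such a mutation also satisfied the Leibniz rule, evaluating that rule at units would give
  \<open>D x * w = 0\<close> for all \<open>x\<close>; as \<open>D (L 1) = L 1\<close> is invertible, \<open>w\<close> and with it the product would
  vanish.
\<close>

section \<open>The Lie algebra of a commutative algebra with a derivation\<close>

context bilinear_operation
begin

sublocale left: Vector_Spaces.linear scale scale "\<lambda>x. bop x y" for y
  by (rule linear_left)

sublocale right: Vector_Spaces.linear scale scale "\<lambda>y. bop x y" for x
  by (rule linear_right)

end

locale differential_algebra = comm_assoc_algebra scale mul
  for scale :: "'k::field \<Rightarrow> 'v::ab_group_add \<Rightarrow> 'v" and mul :: "'v \<Rightarrow> 'v \<Rightarrow> 'v" +
  fixes one :: 'v and D :: "'v \<Rightarrow> 'v"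
  assumes mul_one: "mul x one = x"
    and D_linear: "Vector_Spaces.linear scale scale D"
    and D_mul: "D (mul x y) = mul (D x) y + mul x (D y)"
begin

definition wronskian :: "'v \<Rightarrow> 'v \<Rightarrow> 'v" where
  "wronskian x y = mul (D x) y - mul x (D y)"

sublocale D: Vector_Spaces.linear scale scale D
  by (rule D_linear)

lemma mul_left_commute: "mul x (mul y z) = mul y (mul x z)"
  by (metis mul_assoc mul_commute)

lemmas mul_ac = mul_assoc mul_commute mul_left_commute

lemmas mul_linear = left.add left.diff left.scale right.add right.diff right.scale

lemma D_one: "D one = 0"
  using D_mul[of one one] mul_one[of "D one"] mul_commute[of one "D one"] by (simp add: mul_one)

lemma wronskian_one: "wronskian x one = D x"
  by (simp add: wronskian_def mul_one D_one)

lemma D_mul_eigen: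
  assumes "D x = scale \<alpha> x" "D y = scale \<beta> y"
  shows "D (mul x y) = scale (\<alpha> + \<beta>) (mul x y)"
  by (simp add: D_mul assms mul_linear scale_left_distrib)

lemma wronskian_eigen:
  assumes "D x = scale \<alpha> x" "D y = scale \<beta> y"
  shows "wronskian x y = scale (\<alpha> - \<beta>) (mul x y)"
  by (simp add: wronskian_def assms mul_linear scale_left_diff_distrib)

lemma lie_algebra_wronskian: "lie_algebra scale wronskian"
proof
  show "wronskian x x = 0" for x
    by (simp add: wronskian_def mul_commute)
  show "wronskian x (wronskian y z) + wronskian y (wronskian z x) + wronskian z (wronskian x y) = 0"
    for x y z
    by (simp add: wronskian_def mul_linear D.diff D_mul mul_ac algebra_simps)
qed (simp_all add: wronskian_def mul_linear D.add D.scale algebra_simps scale_right_diff_distrib)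

text \<open>In \<open>[u x, y] + [x, u y]\<close> the derivative of \<open>u\<close> enters as \<open>D u * x * y - x * D u * y\<close>, which is
  zero; what remains is \<open>u [x, y]\<close> from each summand.\<close>

lemma wronskian_half_derivation:
  "scale 2 (mul u (wronskian x y)) = wronskian (mul u x) y + wronskian x (mul u y)"
proof -
  have "scale 2 v = v + v" for v
    using scale_left_distrib[of 1 1 v] by simp
  then show ?thesis
    by (simp add: wronskian_def mul_linear D_mul mul_ac algebra_simps)
qed

lemma comm_assoc_algebra_mutation: "comm_assoc_algebra scale (mutation mul w)"
  by unfold_locales (simp_all add: mutation_def mul_linear mul_ac)

lemma transposed_poisson_mutation:
  assumes "\<exists>x y. mutation mul w x y \<noteq> 0" "\<exists>x y. wronskian x y \<noteq> 0"
  shows "transposed_poisson_algebra scale (mutation mul w) wronskian"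
proof -
  interpret M: comm_assoc_algebra scale "mutation mul w"
    by (rule comm_assoc_algebra_mutation)
  interpret W: lie_algebra scale wronskian
    by (rule lie_algebra_wronskian)
  show ?thesis
    by unfold_locales (use assms in \<open>auto simp: mutation_def intro: wronskian_half_derivation\<close>)
qed

text \<open>With \<open>y = z = one\<close> the Leibniz rule reads \<open>[x, w] = 2 D x * w\<close>. At \<open>x = one\<close> it forces
  \<open>D w = 0\<close>, so that \<open>[x, w]\<close> is also equal to \<open>D x * w\<close>.\<close>

lemma poisson_mutation_annihilates:
  assumes "poisson_algebra scale (mutation mul w) wronskian"
  shows "mul (D x) w = 0"
proof -
  interpret P: poisson_algebra scale "mutation mul w" wronskian by fact
  have one_w: "mutation mul w one one = w"
    by (metis mutation_def mul_commute mul_one)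
  have rec: "wronskian x w = mul (D x) w + mul (D x) w" for x
  proof -
    have "wronskian x w = mul (mul (D x) w) one + mul (mul one w) (D x)"
      using P.leibniz[of x one one] unfolding one_w wronskian_one by (simp add: mutation_def)
    then show ?thesis by (metis mul_commute mul_one)
  qed
  have "mul one (D w) = 0"
    using rec[of one] by (simp add: wronskian_def D_one)
  then have "D w = 0"
    by (metis mul_commute mul_one)
  then show ?thesis
    using rec[of x] by (simp add: wronskian_def)
qed

end

section \<open>Extended Laurent polynomials\<close>

abbreviation unit_vec :: "basis \<Rightarrow> wspace" where
  "unit_vec b \<equiv> Poly_Mapping.single b 1"

notation laurent_mult (infixl "\<star>" 70)

lemma span_unit_vec: "wspace.span (range unit_vec) = UNIV"
proof -
  have "x \<in> wspace.span (range unit_vec)" for x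
  proof -
    have "x = (\<Sum>b\<in>Poly_Mapping.keys x. wscale (Poly_Mapping.lookup x b) (unit_vec b))"
      by (rule poly_mapping_eqI)
        (simp add: lookup_sum Poly_Mapping.lookup_single when_def in_keys_iff if_distrib cong: if_cong)
    also have "\<dots> \<in> wspace.span (range unit_vec)"
      by (intro wspace.span_sum wspace.span_scale wspace.span_base) auto
    finally show ?thesis .
  qed
  then show ?thesis by auto
qed

lemma linear_eq_on_basis:
  assumes "Vector_Spaces.linear wscale wscale f" "Vector_Spaces.linear wscale wscale g"
    and "\<And>b. f (unit_vec b) = g (unit_vec b)"
  shows "f x = g x"
proof -
  interpret vector_space_pair wscale wscale ..
  show ?thesis
    by (rule linear_eq_on[OF assms(1,2), of x "range unit_vec"])
      (use assms(3) span_unit_vec in auto)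
qed

lemma bilinear_eq_on_basis:
  assumes "bilinear_operation wscale f" "bilinear_operation wscale g"
    and "\<And>b c. f (unit_vec b) (unit_vec c) = g (unit_vec b) (unit_vec c)"
  shows "f x y = g x y"
proof -
  interpret F: bilinear_operation wscale f by fact
  interpret G: bilinear_operation wscale g by fact
  have "f (unit_vec b) y = g (unit_vec b) y" for b
    by (rule linear_eq_on_basis[OF F.linear_right G.linear_right assms(3)])
  then show ?thesis
    by (rule linear_eq_on_basis[OF F.linear_left G.linear_left])
qed

global_interpretation laurent: bilinear_operation wscale laurent_mult
  unfolding laurent_mult_def by (rule bilinear_operation_extension)

lemma laurent_mult_basis [simp]: "unit_vec b \<star> unit_vec c = laurent_mult_basis b c"
  by (simp add: laurent_mult_def)

lemma linear_comp:
  assumes "Vector_Spaces.linear wscale wscale f" "Vector_Spaces.linear wscale wscale g"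
  shows "Vector_Spaces.linear wscale wscale (\<lambda>x. f (g x))"
  using Vector_Spaces.linear_compose[OF assms(2,1)] by (simp add: o_def)

global_interpretation laurent: comm_assoc_algebra wscale laurent_mult
proof
  have flip: "bilinear_operation wscale (\<lambda>x y. y \<star> x)"
    by unfold_locales (simp_all add: laurent.left.add laurent.right.add laurent.left.scale laurent.right.scale)
  have basis_commute: "laurent_mult_basis b c = laurent_mult_basis c b" for b c
    by (cases b; cases c) (simp_all add: add.commute)
  show "x \<star> y = y \<star> x" for x y
    by (rule bilinear_eq_on_basis[OF laurent.bilinear_operation_axioms flip]) (simp add: basis_commute)
  have basis: "unit_vec b \<star> unit_vec c \<star> unit_vec d = unit_vec b \<star> (unit_vec c \<star> unit_vec d)" for b c d
    by (cases b; cases c; cases d) (simp_all add: algebra_simps)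
  have basis2: "unit_vec b \<star> unit_vec c \<star> z = unit_vec b \<star> (unit_vec c \<star> z)" for b c z
    by (rule linear_eq_on_basis[where x = z])
      (simp_all add: basis laurent.right.linear_axioms
        linear_comp[of "\<lambda>u. unit_vec b \<star> u" "\<lambda>u. unit_vec c \<star> u"]
        del: laurent_mult_basis)
  have basis1: "unit_vec b \<star> y \<star> z = unit_vec b \<star> (y \<star> z)" for b y z
    by (rule linear_eq_on_basis[where x = y])
      (simp_all add: basis2 laurent.left.linear_axioms laurent.right.linear_axioms
        linear_comp[of "\<lambda>u. u \<star> z" "\<lambda>u. unit_vec b \<star> u"]
        linear_comp[of "\<lambda>u. unit_vec b \<star> u" "\<lambda>u. u \<star> z"]
        del: laurent_mult_basis)
  show "x \<star> y \<star> z = x \<star> (y \<star> z)" for x y z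
    by (rule linear_eq_on_basis[where x = x])
      (simp_all add: basis1 laurent.left.linear_axioms
        linear_comp[of "\<lambda>u. u \<star> z" "\<lambda>u. u \<star> y"])
qed

lemma laurent_mult_one_right: "x \<star> unit_vec (L 0) = x"
proof (rule linear_eq_on_basis[OF laurent.linear_left wspace.linear_ident])
  show "unit_vec b \<star> unit_vec (L 0) = unit_vec b" for b
    by (cases b) simp_all
qed

text \<open>The element \<open>L n\<close> has the inverse \<open>L (- n)\<close>.\<close>

lemma laurent_mult_L_cancel:
  assumes "x \<star> unit_vec (L n) = 0"
  shows "x = 0"
proof -
  have "x = x \<star> unit_vec (L n) \<star> unit_vec (L (- n))"
    by (simp add: laurent.mul_assoc laurent_mult_one_right)
  also have "\<dots> = 0"
    using assms by simp
  finally show ?thesis .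
qed

section \<open>The degree derivation\<close>

text \<open>The shift by \<open>a\<close> on the \<open>I\<close> part is what makes the Wronskian reproduce the coefficient
  \<open>m - (n + a)\<close> of the bracket of \<open>L m\<close> with \<open>I n\<close>.\<close>

fun weight :: "complex \<Rightarrow> basis \<Rightarrow> complex" where
  "weight a (L m) = of_int m"
| "weight a (I n) = of_int n + a"

definition degree_derivation :: "complex \<Rightarrow> wspace \<Rightarrow> wspace" where
  "degree_derivation a = Poly_Mapping.mapp (\<lambda>b c. weight a b * c)"

lemma lookup_degree_derivation [simp]:
  "Poly_Mapping.lookup (degree_derivation a x) b = weight a b * Poly_Mapping.lookup x b"
  by (simp add: degree_derivation_def lookup_mapp when_def in_keys_iff)

lemma degree_derivation_unit_vec:
  "degree_derivation a (unit_vec b) = wscale (weight a b) (unit_vec b)"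
  by (rule poly_mapping_eqI) (simp add: Poly_Mapping.lookup_single when_def)

lemma linear_degree_derivation: "Vector_Spaces.linear wscale wscale (degree_derivation a)"
  by unfold_locales (auto intro!: poly_mapping_eqI simp: Poly_Mapping.lookup_add algebra_simps)

global_interpretation laurent_diff:
  differential_algebra wscale laurent_mult "unit_vec (L 0)" "degree_derivation a" for a
proof (intro differential_algebra.intro[OF laurent.comm_assoc_algebra_axioms]
    differential_algebra_axioms.intro)
  show "x \<star> unit_vec (L 0) = x" for x
    by (rule laurent_mult_one_right)
  show "Vector_Spaces.linear wscale wscale (degree_derivation a)"
    by (rule linear_degree_derivation)
  interpret D: Vector_Spaces.linear wscale wscale "degree_derivation a"
    by (rule linear_degree_derivation)
  have lhs: "bilinear_operation wscale (\<lambda>x y. degree_derivation a (x \<star> y))"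
    by unfold_locales (simp_all add: laurent.left.add laurent.right.add
        laurent.left.scale laurent.right.scale D.add D.scale)
  have rhs: "bilinear_operation wscale (\<lambda>x y. degree_derivation a x \<star> y + x \<star> degree_derivation a y)"
    by unfold_locales (simp_all add: laurent.left.add laurent.right.add laurent.left.scale
        laurent.right.scale D.add D.scale algebra_simps)
  show "degree_derivation a (x \<star> y) = degree_derivation a x \<star> y + x \<star> degree_derivation a y" for x y
  proof (rule bilinear_eq_on_basis[OF lhs rhs])
    fix b c
    show "degree_derivation a (unit_vec b \<star> unit_vec c) =
        degree_derivation a (unit_vec b) \<star> unit_vec c + unit_vec b \<star> degree_derivation a (unit_vec c)"
      by (cases b; cases c)
        (simp_all add: degree_derivation_unit_vec laurent.left.scale laurent.right.scale D.zero
          flip: wspace.scale_left_distrib)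
  qed
qed

text \<open>On basis vectors, which are eigenvectors of the derivation, the Wronskian is the difference of
  the weights times the product. It vanishes on two \<open>I\<close>'s because their product does.\<close>

lemma W_bracket_eq_wronskian: "W_bracket a = laurent_diff.wronskian a"
proof (intro ext)
  fix x y
  interpret Lie: lie_algebra wscale "laurent_diff.wronskian a"
    by (rule laurent_diff.lie_algebra_wronskian)
  show "W_bracket a x y = laurent_diff.wronskian a x y"
  proof (rule bilinear_eq_on_basis[of "W_bracket a" "laurent_diff.wronskian a"])
    show "bilinear_operation wscale (W_bracket a)"
      unfolding W_bracket_def by (rule bilinear_operation_extension)
    show "bilinear_operation wscale (laurent_diff.wronskian a)"
      by (rule Lie.bilinear_operation_axioms)
    fix b c
    have "laurent_diff.wronskian a (unit_vec b) (unit_vec c) =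
        wscale (weight a b - weight a c) (laurent_mult_basis b c)"
      by (simp add: laurent_diff.wronskian_eigen[OF degree_derivation_unit_vec degree_derivation_unit_vec])
    also have "\<dots> = W_bracket a (unit_vec b) (unit_vec c)"
      by (cases b; cases c) (auto intro!: poly_mapping_eqI simp: W_bracket_def Poly_Mapping.lookup_single when_def)
    finally show "W_bracket a (unit_vec b) (unit_vec c) = laurent_diff.wronskian a (unit_vec b) (unit_vec c)" ..
  qed
qed

section \<open>Half-derivations\<close>

lemma lookup_eigenvector:
  assumes "degree_derivation a v = wscale \<alpha> v" "weight a b \<noteq> \<alpha>"
  shows "Poly_Mapping.lookup v b = 0"
proof -
  have "weight a b * Poly_Mapping.lookup v b = \<alpha> * Poly_Mapping.lookup v b"
    using arg_cong[OF assms(1), of "\<lambda>v. Poly_Mapping.lookup v b"] by simp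
  then show ?thesis using assms(2) by simp
qed

text \<open>Since \<open>L n\<close> is invertible, it suffices to find for each basis vector \<open>x\<close> an \<open>n\<close> with
  \<open>\<psi> x * L n = 0\<close>. Write \<open>\<alpha>\<close> for the weight of \<open>x\<close> and \<open>\<beta> = n\<close> for that of \<open>y = L n\<close>. In the
  half-derivation identity the term \<open>[\<psi> x, y] = (2 \<alpha> - \<beta>) \<psi> x * y\<close> has weight \<open>2 \<alpha> + \<beta>\<close>. This differs
  from the weight \<open>2 \<alpha> + 2 \<beta>\<close> of \<open>2 \<psi> [x, y]\<close> if \<open>\<beta> \<noteq> 0\<close>, and from the weight \<open>\<alpha> + 2 \<beta>\<close> of
  \<open>[x, \<psi> y]\<close> if \<open>\<beta> \<noteq> \<alpha>\<close>. So any \<open>n\<close> other than \<open>0\<close>, \<open>\<alpha>\<close> and \<open>2 \<alpha>\<close> works.\<close>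

lemma half_derivation_vanishing_at_one:
  assumes lin: "Vector_Spaces.linear wscale wscale \<psi>"
    and half: "\<And>x y. wscale 2 (\<psi> (W_bracket a x y)) = W_bracket a (\<psi> x) y + W_bracket a x (\<psi> y)"
    and one: "\<psi> (unit_vec (L 0)) = 0"
  shows "\<psi> x = 0"
proof -
  interpret \<psi>: Vector_Spaces.linear wscale wscale \<psi> by fact
  let ?D = "degree_derivation a"
  have eigen: "?D (\<psi> x) = wscale (2 * \<alpha>) (\<psi> x)" if "?D x = wscale \<alpha> x" for x \<alpha>
  proof -
    have "laurent_diff.wronskian a x 0 = 0"
      by (simp add: laurent_diff.wronskian_def laurent.right.zero laurent_diff.D.zero)
    with half[of x "unit_vec (L 0)"] that show ?thesis
      by (simp add: W_bracket_eq_wronskian laurent_diff.wronskian_one one \<psi>.scale)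
  qed
  have kill: "\<psi> x \<star> y = 0"
    if x: "?D x = wscale \<alpha> x" and y: "?D y = wscale \<beta> y"
      and "\<beta> \<noteq> 0" "\<beta> \<noteq> \<alpha>" "\<beta> \<noteq> 2 * \<alpha>" for x y \<alpha> \<beta>
  proof (rule poly_mapping_eqI)
    fix b
    note xy = laurent_diff.D_mul_eigen[OF x y]
    note \<psi>xy = laurent_diff.D_mul_eigen[OF eigen[OF x] y]
    note x\<psi>y = laurent_diff.D_mul_eigen[OF x eigen[OF y]]
    have "wscale 2 (wscale (\<alpha> - \<beta>) (\<psi> (x \<star> y))) =
        wscale (2 * \<alpha> - \<beta>) (\<psi> x \<star> y) + wscale (\<alpha> - 2 * \<beta>) (x \<star> \<psi> y)"
      using half[of x y]
      by (simp only: W_bracket_eq_wronskian laurent_diff.wronskian_eigen[OF x y] \<psi>.scale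
        laurent_diff.wronskian_eigen[OF eigen[OF x] y] laurent_diff.wronskian_eigen[OF x eigen[OF y]])
    from arg_cong[OF this, of "\<lambda>v. Poly_Mapping.lookup v b"]
    have coeff: "(2 * \<alpha> - 2 * \<beta>) * Poly_Mapping.lookup (\<psi> (x \<star> y)) b =
        (2 * \<alpha> - \<beta>) * Poly_Mapping.lookup (\<psi> x \<star> y) b +
        (\<alpha> - 2 * \<beta>) * Poly_Mapping.lookup (x \<star> \<psi> y) b"
      by (simp add: Poly_Mapping.lookup_add)
    \<comment> \<open>Only coefficients at weight \<open>2 \<alpha> + \<beta>\<close> can be nonzero in \<open>\<psi> x \<star> y\<close>, and there the
      other two terms contribute nothing.\<close>
    show "Poly_Mapping.lookup (\<psi> x \<star> y) b = Poly_Mapping.lookup 0 b"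
    proof (cases "weight a b = 2 * \<alpha> + \<beta>")
      case True
      have "Poly_Mapping.lookup (\<psi> (x \<star> y)) b = 0"
        by (rule lookup_eigenvector[OF eigen[OF xy]]) (use True \<open>\<beta> \<noteq> 0\<close> in \<open>simp add: algebra_simps\<close>)
      moreover have "Poly_Mapping.lookup (x \<star> \<psi> y) b = 0"
        by (rule lookup_eigenvector[OF x\<psi>y]) (use True \<open>\<beta> \<noteq> \<alpha>\<close> in \<open>simp add: algebra_simps\<close>)
      ultimately show ?thesis
        using coeff \<open>\<beta> \<noteq> 2 * \<alpha>\<close> by simp
    next
      case False
      then show ?thesis
        by (simp add: lookup_eigenvector[OF \<psi>xy])
    qed
  qed
  have basis: "\<psi> (unit_vec b) = 0" for b
  proof -
    \<comment> \<open>Two values are excluded besides zero, so one of three positive integers is left.\<close>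
    obtain n :: int where n: "n \<in> {1, 2, 3}" "of_int n \<noteq> weight a b" "of_int n \<noteq> 2 * weight a b"
    proof -
      have "\<exists>n\<in>{1, 2, 3 :: int}. of_int n \<noteq> weight a b \<and> of_int n \<noteq> 2 * weight a b"
        by auto
      then show ?thesis using that by blast
    qed
    have "\<psi> (unit_vec b) \<star> unit_vec (L n) = 0"
      by (rule kill[OF degree_derivation_unit_vec degree_derivation_unit_vec]) (use n in auto)
    then show ?thesis by (rule laurent_mult_L_cancel)
  qed
  have zero: "Vector_Spaces.linear wscale wscale (\<lambda>_. 0)"
    by unfold_locales simp_all
  show ?thesis
    by (rule linear_eq_on_basis[OF lin zero basis])
qed

text \<open>Multiplication by \<open>\<phi> 1\<close> is a half-derivation that agrees with \<open>\<phi>\<close> at \<open>1\<close>; the difference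
  is one that vanishes there.\<close>

lemma half_derivation_eq_multiplication:
  assumes lin: "Vector_Spaces.linear wscale wscale \<phi>"
    and half: "\<And>x y. wscale 2 (\<phi> (W_bracket a x y)) = W_bracket a (\<phi> x) y + W_bracket a x (\<phi> y)"
  shows "\<phi> x = \<phi> (unit_vec (L 0)) \<star> x"
proof -
  interpret \<phi>: Vector_Spaces.linear wscale wscale \<phi> by fact
  interpret Lie: lie_algebra wscale "W_bracket a"
    unfolding W_bracket_eq_wronskian by (rule laurent_diff.lie_algebra_wronskian)
  let ?u = "\<phi> (unit_vec (L 0))"
  have "\<phi> x - ?u \<star> x = 0"
  proof (rule half_derivation_vanishing_at_one[where a = a and \<psi> = "\<lambda>x. \<phi> x - ?u \<star> x"])
    show "Vector_Spaces.linear wscale wscale (\<lambda>x. \<phi> x - ?u \<star> x)"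
      by unfold_locales (simp_all add: \<phi>.add \<phi>.scale laurent.right.add laurent.right.scale
          wspace.scale_right_diff_distrib)
    show "\<phi> (unit_vec (L 0)) - ?u \<star> unit_vec (L 0) = 0"
      by (simp add: laurent_mult_one_right)
    show "wscale 2 (\<phi> (W_bracket a x y) - ?u \<star> W_bracket a x y) =
        W_bracket a (\<phi> x - ?u \<star> x) y + W_bracket a x (\<phi> y - ?u \<star> y)" for x y
      using half[of x y] laurent_diff.wronskian_half_derivation[of ?u a x y]
      by (simp add: wspace.scale_right_diff_distrib Lie.left.diff Lie.right.diff
          flip: W_bracket_eq_wronskian)
  qed
  then show ?thesis by simp
qed

section \<open>Transposed Poisson structures\<close>

text \<open>The transposed Leibniz rule says that each multiplication \<open>x \<mapsto> mul z x\<close> is a half-derivation.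
  Reducing the second factor to \<open>L 0\<close> and then, by commutativity, the first one leaves only
  the square of \<open>L 0\<close>.\<close>

lemma transposed_poisson_eq_mutation:
  assumes "transposed_poisson_algebra wscale mul (W_bracket a)"
  shows "mul = mutation laurent_mult (mul (unit_vec (L 0)) (unit_vec (L 0)))"
proof (intro ext)
  fix z x
  interpret T: transposed_poisson_algebra wscale mul "W_bracket a" by fact
  let ?e = "unit_vec (L 0)"
  have mult: "mul z x = mul z ?e \<star> x" for z x
    by (rule half_derivation_eq_multiplication[OF T.mult.linear_right T.transposed_leibniz])
  have "mul z ?e = z \<star> mul ?e ?e"
    using mult[of ?e z] by (simp add: T.mult.mul_commute laurent.mul_commute)
  with mult[of z x] show "mul z x = mutation laurent_mult (mul ?e ?e) z x"
    by (simp add: mutation_def)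
qed

theorem theorem24:
  fixes a :: complex
  shows "(\<forall>mul. transposed_poisson_algebra wscale mul (W_bracket a) \<longrightarrow>
            \<not> poisson_algebra wscale mul (W_bracket a) \<and>
            (\<exists>w. mul = mutation laurent_mult w)) \<and>
         (\<forall>w. (\<exists>x y. mutation laurent_mult w x y \<noteq> 0) \<longrightarrow>
            transposed_poisson_algebra wscale (mutation laurent_mult w) (W_bracket a))"
proof (intro conjI allI impI)
  fix mul
  assume tp: "transposed_poisson_algebra wscale mul (W_bracket a)"
  obtain w where w: "mul = mutation laurent_mult w"
    using transposed_poisson_eq_mutation[OF tp] by blast
  then show "\<exists>w. mul = mutation laurent_mult w" ..
  show "\<not> poisson_algebra wscale mul (W_bracket a)"
  proof
    assume "poisson_algebra wscale mul (W_bracket a)"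
    then have "degree_derivation a (unit_vec (L 1)) \<star> w = 0"
      unfolding w W_bracket_eq_wronskian by (rule laurent_diff.poisson_mutation_annihilates)
    then have "w \<star> unit_vec (L 1) = 0"
      by (simp add: degree_derivation_unit_vec laurent.mul_commute)
    then have "w = 0"
      by (rule laurent_mult_L_cancel)
    then have "mul x y = 0" for x y
      by (simp add: w mutation_def laurent.left.zero laurent.right.zero)
    with transposed_poisson_algebra.mul_nonzero[OF tp] show False
      by blast
  qed
next
  fix w
  assume nonzero: "\<exists>x y. mutation laurent_mult w x y \<noteq> 0"
  have "W_bracket a (unit_vec (L 1)) (unit_vec (L 0)) = unit_vec (L 1)"
    by (simp add: W_bracket_def)
  then have "W_bracket a (unit_vec (L 1)) (unit_vec (L 0)) \<noteq> 0"
    by (metis Poly_Mapping.lookup_single_eq Poly_Mapping.lookup_zero zero_neq_one)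
  then show "transposed_poisson_algebra wscale (mutation laurent_mult w) (W_bracket a)"
    unfolding W_bracket_eq_wronskian
    by (intro laurent_diff.transposed_poisson_mutation nonzero) blast
qed

end
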